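(* Let $G$ be a countable group (with the discrete topology), $X$ a Hausdorff locally compact paracompact space with a countable basis, and $\varphi: G \curvearrowright X$ a properly discontinuous cocompact action. Let $x_0\in X$, let $\varphi_{x_0}:(G,\varepsilon_G)\to(X,\varepsilon_\varphi)$, $\varphi_{x_0}(g)=\varphi(g,x_0)$ (this map is a coarse equivalence), and let $\psi_{x_0}:(X,\varepsilon_\varphi)\to(G,\varepsilon_G)$ be a coarse inverse of $\varphi_{x_0}$. Let $\Pi: EMPers_0(G)\to EMPers_0(\varphi)$ be the functor given by the action $\varphi$, and let $\Pi': MPers(\varepsilon_G)\to MPers(\varepsilon_\varphi)$ be the functor defined by the pullback with respect to $\psi_{x_0}$. Then $\Pi'|_{EMPers_0(G)}=\Pi$.
   Context: Glueings. $Closed(X)$ is the set of closed subsets of $X$. A map $f:Closed(X)\to Closed(Y)$ is admissible if $f(\emptyset)=\emptyset$ and $f(A\cup B)=f(A)\cup f(B)$. $X+_fY$ is the disjoint union $X\dot\cup Y$ where $C$ is closed iff $C\cap X$ is closed in $X$, $C\cap Y$ is closed in $Y$ and $f(C\cap X)\subseteq C$. Every space that is the disjoint union of an open subspace $X$ and its complement $Y$ is uniquely of this form. For maps $\alpha: X\to Z$, $\beta: Y\to W$, $\alpha+\beta: X+_fY\to Z+_hW$ is $\alpha$ on $X$ and $\beta$ on $Y$. Coarse structures. A coarse structure on $X$ is a set $\varepsilon$ of subsets of $X\times X$ containing the diagonal and closed under subsets, finite unions, inverses and compositions. $B\subseteq X$ is bounded if $B\times B\in\varepsilon$. A map is bornologous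 if it sends elements of the coarse structure to elements of the coarse structure, proper if preimages of bounded sets are bounded, coarse if both. Maps $f,g:S\to X$ are close if $\{(f(s),g(s)):s\in S\}\in\varepsilon$. A coarse map is a coarse equivalence if it has a coarse inverse, i.e. a coarse map in the other direction such that both compositions are close to the identities. A subset of a topological space is topologically bounded if its closure is compact. The action $\varphi$ (by homeomorphisms) is properly discontinuous if $\{g:\varphi(g,K)\cap K\ne\emptyset\}$ is finite for each compact $K$; cocompact if $X/\varphi$ is compact. For $A\subseteq X$ let $Sat(A)=\{(\varphi(g,x),\varphi(g,x')):g\in G,\ x,x'\in A\}$. $\varepsilon_\varphi$ is the coarse structure generated by (smallest containing) all $Sat(A)$ with $A$ topologically bounded; $\varepsilon_G$ is $\varepsilon_\varphi$ for $X=G$ and $\varphi$ the left multiplication action. Coarse geometric perspectivity. A compactification of $X$ is a Hausdorff compact space containing $X$ as a dense subspace. For a compactification $\bar X=X+_fW$ of a locally compact paracompact Hausdorff $X$, $\varepsilon_f$ is the set of $e\subseteq X\times X$ with $Cl_{\bar X^2}(e)\cap(\bar X^2-X^2)\subseteq\{(w,w):w\in W\}$. For a coarse structure $\varepsilon$ on $X$, $X+_fW$ is perspective if $\varepsilon\subseteq\varepsilon_f$. $MPers(\varepsilon)$ is the category whose objects are metrizable perspective compactifications $X+_fW$ and whose morphisms are continuous maps that are the identity on $X$. Group theoretic perspectivity. A compactification $\bar X$ of $X$ is perspective with respect to $\varphi$ if $\varphi$ extends continuously to an action on $\bar X$ and for every entourage $u$ of the unique uniform structure compatible with the topology of $\bar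 X$ and every compact $K\subseteq X$, the set $\{g\in G:\varphi(g,K)\times\varphi(g,K)\not\subseteq u\}$ is finite. $EMPers_0(\varphi)$ is the category of metrizable such compactifications with equivariant continuous maps that are the identity on $X$; $EMPers_0(G)$ is the case $X=G$ with left multiplication. $EMPers_0(\varphi)$ is a subcategory of $MPers(\varepsilon_\varphi)$ and $EMPers_0(G)$ is a subcategory of $MPers(\varepsilon_G)$. Functors. Let $K\subseteq X$ be a compact set with $\varphi(G,K)=X$ (a fundamental domain). $\Pi$ sends $G+_\partial Y$ to $X+_{\partial_\Pi}Y$ with $\partial_\Pi(S)=\partial(\{g\in G:\varphi(g,K)\cap S\neq\emptyset\})$ for $S\in Closed(X)$, and sends a morphism $id+\phi$ to $id+\phi$; it is known to be well defined and independent of the choice of $K$. $\Pi'$ sends $G+_\partial Y$ to $X+_{\partial^*}Y$ with $\partial^*(S)=\partial(\psi_{x_0}(S))$ (the pullback), and sends $id+\phi$ to $id+\phi$; it is known to be well defined. *)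

theory Defs
  imports "HOL-Analysis.Analysis" "HOL-Algebra.Group_Action"
begin

section \<open>Glueings\<close>

text \<open>Admissible maps are taken to be extensional, so that two of them are equal as HOL functions
  iff they agree on \<^term>\<open>Collect (closedin X)\<close>.\<close>

definition admissible :: "'x topology \<Rightarrow> 'y topology \<Rightarrow> ('x set \<Rightarrow> 'y set) \<Rightarrow> bool" where
  "admissible X Y f \<longleftrightarrow>
     f \<in> Collect (closedin X) \<rightarrow>\<^sub>E Collect (closedin Y) \<and>
     f {} = {} \<and>
     (\<forall>A B. closedin X A \<longrightarrow> closedin X B \<longrightarrow> f (A \<union> B) = f A \<union> f B)"

definition glue_closed :: "'x topology \<Rightarrow> ('x set \<Rightarrow> 'y set) \<Rightarrow> 'y topology \<Rightarrow> ('x + 'y) set \<Rightarrow> bool" where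
  "glue_closed X f Y C \<longleftrightarrow>
     closedin X (Inl -` C) \<and> closedin Y (Inr -` C) \<and> f (Inl -` C) \<subseteq> Inr -` C"

definition glue :: "'x topology \<Rightarrow> ('x set \<Rightarrow> 'y set) \<Rightarrow> 'y topology \<Rightarrow> ('x + 'y) topology" where
  "glue X f Y = topology (\<lambda>U. U \<subseteq> topspace X <+> topspace Y \<and>
                               glue_closed X f Y ((topspace X <+> topspace Y) - U))"

lemma admissible_mono:
  assumes "admissible X Y f" "closedin X A" "closedin X B" "A \<subseteq> B"
  shows "f A \<subseteq> f B"
  using assms unfolding admissible_def by (metis Un_upper1 sup.absorb2)

lemma istopology_glue:
  assumes "admissible X Y f"
  shows "istopology (\<lambda>U. U \<subseteq> topspace X <+> topspace Y \<and>
                          glue_closed X f Y ((topspace X <+> topspace Y) - U))"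
  unfolding istopology_def
proof (intro conjI allI impI)
  let ?S = "topspace X <+> topspace Y"
  fix U V :: "('a + 'b) set"
  assume U: "U \<subseteq> ?S \<and> glue_closed X f Y (?S - U)" and V: "V \<subseteq> ?S \<and> glue_closed X f Y (?S - V)"
  show "U \<inter> V \<subseteq> ?S" using U by blast
  have "?S - U \<inter> V = (?S - U) \<union> (?S - V)" by blast
  then show "glue_closed X f Y (?S - U \<inter> V)"
    using U V assms unfolding glue_closed_def admissible_def
    by (auto simp: vimage_Un closedin_Un)
next
  let ?S = "topspace X <+> topspace Y"
  fix K :: "('a + 'b) set set"
  assume K: "\<forall>U\<in>K. U \<subseteq> ?S \<and> glue_closed X f Y (?S - U)"
  show "\<Union>K \<subseteq> ?S" using K by blast
  show "glue_closed X f Y (?S - \<Union>K)"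
  proof (cases "K = {}")
    case True
    have [simp]: "Inl -` ?S = topspace X" "Inr -` ?S = topspace Y" by auto
    have "f (topspace X) \<subseteq> topspace Y"
      using assms closedin_subset[of Y "f (topspace X)"] unfolding admissible_def by auto
    then show ?thesis using True by (simp add: glue_closed_def)
  next
    case False
    have l: "Inl -` (?S - \<Union>K) = (\<Inter>U\<in>K. Inl -` (?S - U))"
      and r: "Inr -` (?S - \<Union>K) = (\<Inter>U\<in>K. Inr -` (?S - U))" using False by auto
    have cl: "closedin X (Inl -` (?S - \<Union>K))" unfolding l
      using K False by (intro closedin_INT) (auto simp: glue_closed_def)
    have cr: "closedin Y (Inr -` (?S - \<Union>K))" unfolding r
      using K False by (intro closedin_INT) (auto simp: glue_closed_def)
    have "f (Inl -` (?S - \<Union>K)) \<subseteq> Inr -` (?S - U)" if "U \<in> K" for U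
    proof -
      have "f (Inl -` (?S - \<Union>K)) \<subseteq> f (Inl -` (?S - U))"
        using K that by (intro admissible_mono[OF assms cl]) (auto simp: glue_closed_def)
      then show ?thesis using K that unfolding glue_closed_def by blast
    qed
    then have "f (Inl -` (?S - \<Union>K)) \<subseteq> Inr -` (?S - \<Union>K)" unfolding r by blast
    then show ?thesis using cl cr by (simp add: glue_closed_def)
  qed
qed

lemma topspace_glue:
  assumes "admissible X Y f"
  shows "topspace (glue X f Y) = topspace X <+> topspace Y"
proof -
  let ?S = "topspace X <+> topspace Y"
  have o: "openin (glue X f Y) U \<longleftrightarrow> U \<subseteq> ?S \<and> glue_closed X f Y (?S - U)" for U
    by (simp add: glue_def topology_inverse'[OF istopology_glue[OF assms]])
  have "openin (glue X f Y) ?S"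
    using assms by (auto simp: o glue_closed_def admissible_def)
  then show ?thesis
    using o[of "topspace (glue X f Y)"] openin_subset by blast
qed

lemma closedin_glue:
  assumes "admissible X Y f"
  shows "closedin (glue X f Y) C \<longleftrightarrow> glue_closed X f Y C"
proof -
  let ?S = "topspace X <+> topspace Y"
  have sub: "C \<subseteq> ?S" if C: "glue_closed X f Y C"
  proof -
    have "Inl -` C \<subseteq> topspace X" "Inr -` C \<subseteq> topspace Y"
      using C by (auto simp: glue_closed_def dest!: closedin_subset)
    then show ?thesis by (auto simp: vimage_def Plus_def image_iff) (metis sumE mem_Collect_eq subsetD)
  qed
  have "C \<subseteq> ?S \<Longrightarrow> ?S - (?S - C) = C" by blast
  then show ?thesis
    using sub unfolding closedin_def topspace_glue[OF assms]
      topology_inverse'[OF istopology_glue[OF assms], folded glue_def] by auto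
qed

section \<open>Coarse structures\<close>

definition coarse_structure :: "'a set \<Rightarrow> ('a \<times> 'a) set set \<Rightarrow> bool" where
  "coarse_structure S E \<longleftrightarrow>
     E \<subseteq> Pow (S \<times> S) \<and> Id_on S \<in> E \<and>
     (\<forall>e\<in>E. \<forall>d. d \<subseteq> e \<longrightarrow> d \<in> E) \<and>
     (\<forall>e\<in>E. \<forall>d\<in>E. e \<union> d \<in> E) \<and>
     (\<forall>e\<in>E. e\<inverse> \<in> E) \<and>
     (\<forall>e\<in>E. \<forall>d\<in>E. e O d \<in> E)"

definition coarse_generated :: "'a set \<Rightarrow> ('a \<times> 'a) set set \<Rightarrow> ('a \<times> 'a) set set" where
  "coarse_generated S B = \<Inter>{E. coarse_structure S E \<and> B \<subseteq> E}"

definition coarse_bounded :: "'a set \<Rightarrow> ('a \<times> 'a) set set \<Rightarrow> 'a set \<Rightarrow> bool" where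
  "coarse_bounded S E B \<longleftrightarrow> B \<subseteq> S \<and> B \<times> B \<in> E"

definition bornologous where
  "bornologous S E T F f \<longleftrightarrow> f \<in> S \<rightarrow> T \<and> (\<forall>e\<in>E. map_prod f f ` e \<in> F)"

definition coarsely_proper where
  "coarsely_proper S E T F f \<longleftrightarrow>
     f \<in> S \<rightarrow> T \<and> (\<forall>B. coarse_bounded T F B \<longrightarrow> coarse_bounded S E {s \<in> S. f s \<in> B})"

definition coarse_map ::
    "'a set \<Rightarrow> ('a \<times> 'a) set set \<Rightarrow> 'b set \<Rightarrow> ('b \<times> 'b) set set \<Rightarrow> ('a \<Rightarrow> 'b) \<Rightarrow> bool" where
  "coarse_map S E T F f \<longleftrightarrow> bornologous S E T F f \<and> coarsely_proper S E T F f"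

definition close_maps :: "'s set \<Rightarrow> ('a \<times> 'a) set set \<Rightarrow> ('s \<Rightarrow> 'a) \<Rightarrow> ('s \<Rightarrow> 'a) \<Rightarrow> bool" where
  "close_maps S E f g \<longleftrightarrow> {(f s, g s) | s. s \<in> S} \<in> E"

text \<open>Coarseness of \<open>f\<close> itself is not part of \<open>coarse_inverse\<close>.\<close>

definition coarse_inverse ::
    "'a set \<Rightarrow> ('a \<times> 'a) set set \<Rightarrow> 'b set \<Rightarrow> ('b \<times> 'b) set set \<Rightarrow> ('a \<Rightarrow> 'b) \<Rightarrow> ('b \<Rightarrow> 'a) \<Rightarrow> bool" where
  "coarse_inverse S E T F f g \<longleftrightarrow>
     coarse_map T F S E g \<and> close_maps S E (g \<circ> f) id \<and> close_maps T F (f \<circ> g) id"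

section \<open>Actions on topological spaces\<close>

definition paracompact_space :: "'x topology \<Rightarrow> bool" where
  "paracompact_space X \<longleftrightarrow>
     (\<forall>\<U>. (\<forall>U\<in>\<U>. openin X U) \<and> \<Union>\<U> = topspace X \<longrightarrow>
        (\<exists>\<V>. (\<forall>V\<in>\<V>. openin X V) \<and> \<Union>\<V> = topspace X \<and>
              (\<forall>V\<in>\<V>. \<exists>U\<in>\<U>. V \<subseteq> U) \<and> locally_finite_in X \<V>))"

definition action_by_homeos :: "('g, 'm) monoid_scheme \<Rightarrow> 'x topology \<Rightarrow> ('g \<Rightarrow> 'x \<Rightarrow> 'x) \<Rightarrow> bool" where
  "action_by_homeos G X \<phi> \<longleftrightarrow>
     group_action G (topspace X) \<phi> \<and> (\<forall>g\<in>carrier G. homeomorphic_map X X (\<phi> g))"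

definition properly_discontinuous where
  "properly_discontinuous G X \<phi> \<longleftrightarrow>
     (\<forall>K. compactin X K \<longrightarrow> finite {g \<in> carrier G. \<phi> g ` K \<inter> K \<noteq> {}})"

text \<open>The quotient topology on the set of orbits.\<close>

definition orbit_space :: "('g, 'm) monoid_scheme \<Rightarrow> 'x topology \<Rightarrow> ('g \<Rightarrow> 'x \<Rightarrow> 'x) \<Rightarrow> 'x set topology" where
  "orbit_space G X \<phi> =
     topology (\<lambda>U. U \<subseteq> orbits G (topspace X) \<phi> \<and> openin X {x \<in> topspace X. orbit G \<phi> x \<in> U})"

lemma openin_orbit_space:
  "openin (orbit_space G X \<phi>) U \<longleftrightarrow>
     U \<subseteq> orbits G (topspace X) \<phi> \<and> openin X {x \<in> topspace X. orbit G \<phi> x \<in> U}"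
proof -
  have "istopology (\<lambda>U. U \<subseteq> orbits G (topspace X) \<phi> \<and> openin X {x \<in> topspace X. orbit G \<phi> x \<in> U})"
    unfolding istopology_def
  proof (intro conjI allI impI)
    fix S T
    assume "S \<subseteq> orbits G (topspace X) \<phi> \<and> openin X {x \<in> topspace X. orbit G \<phi> x \<in> S}"
      and "T \<subseteq> orbits G (topspace X) \<phi> \<and> openin X {x \<in> topspace X. orbit G \<phi> x \<in> T}"
    moreover have "{x \<in> topspace X. orbit G \<phi> x \<in> S \<inter> T} =
        {x \<in> topspace X. orbit G \<phi> x \<in> S} \<inter> {x \<in> topspace X. orbit G \<phi> x \<in> T}" by blast
    ultimately show "S \<inter> T \<subseteq> orbits G (topspace X) \<phi>"
      and "openin X {x \<in> topspace X. orbit G \<phi> x \<in> S \<inter> T}" by auto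
  next
    fix K
    assume K: "\<forall>S\<in>K. S \<subseteq> orbits G (topspace X) \<phi> \<and> openin X {x \<in> topspace X. orbit G \<phi> x \<in> S}"
    then show "\<Union>K \<subseteq> orbits G (topspace X) \<phi>" by blast
    have "{x \<in> topspace X. orbit G \<phi> x \<in> \<Union>K} = (\<Union>S\<in>K. {x \<in> topspace X. orbit G \<phi> x \<in> S})" by blast
    then show "openin X {x \<in> topspace X. orbit G \<phi> x \<in> \<Union>K}" using K by auto
  qed
  then show ?thesis by (simp add: orbit_space_def topology_inverse')
qed

definition cocompact where
  "cocompact G X \<phi> \<longleftrightarrow> compact_space (orbit_space G X \<phi>)"

definition topologically_bounded :: "'x topology \<Rightarrow> 'x set \<Rightarrow> bool" where
  "topologically_bounded X A \<longleftrightarrow> A \<subseteq> topspace X \<and> compactin X (X closure_of A)"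

definition Sat :: "('g, 'm) monoid_scheme \<Rightarrow> ('g \<Rightarrow> 'x \<Rightarrow> 'x) \<Rightarrow> 'x set \<Rightarrow> ('x \<times> 'x) set" where
  "Sat G \<phi> A = {(\<phi> g x, \<phi> g x') | g x x'. g \<in> carrier G \<and> x \<in> A \<and> x' \<in> A}"

definition action_coarse ::
    "('g, 'm) monoid_scheme \<Rightarrow> 'x topology \<Rightarrow> ('g \<Rightarrow> 'x \<Rightarrow> 'x) \<Rightarrow> ('x \<times> 'x) set set" where
  "action_coarse G X \<phi> = coarse_generated (topspace X) {Sat G \<phi> A | A. topologically_bounded X A}"

definition group_top :: "('g, 'm) monoid_scheme \<Rightarrow> 'g topology" where
  "group_top G = discrete_topology (carrier G)"

definition left_mult :: "('g, 'm) monoid_scheme \<Rightarrow> 'g \<Rightarrow> 'g \<Rightarrow> 'g" where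
  "left_mult G g = (\<lambda>h\<in>carrier G. g \<otimes>\<^bsub>G\<^esub> h)"

definition group_coarse :: "('g, 'm) monoid_scheme \<Rightarrow> ('g \<times> 'g) set set" where
  "group_coarse G = action_coarse G (group_top G) (left_mult G)"

section \<open>Perspective compactifications\<close>

definition compactification :: "'x topology \<Rightarrow> ('x set \<Rightarrow> 'y set) \<Rightarrow> 'y topology \<Rightarrow> bool" where
  "compactification X f Y \<longleftrightarrow>
     admissible X Y f \<and> compact_space (glue X f Y) \<and> Hausdorff_space (glue X f Y) \<and>
     glue X f Y closure_of (Inl ` topspace X) = topspace (glue X f Y)"

definition glue_coarse :: "'x topology \<Rightarrow> ('x set \<Rightarrow> 'y set) \<Rightarrow> 'y topology \<Rightarrow> ('x \<times> 'x) set set" where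
  "glue_coarse X f Y =
     {e. e \<subseteq> topspace X \<times> topspace X \<and>
         (prod_topology (glue X f Y) (glue X f Y) closure_of (map_prod Inl Inl ` e)) \<inter>
         (topspace (glue X f Y) \<times> topspace (glue X f Y) - Inl ` topspace X \<times> Inl ` topspace X)
         \<subseteq> {(Inr w, Inr w) | w. w \<in> topspace Y}}"

definition coarsely_perspective where
  "coarsely_perspective X E f Y \<longleftrightarrow> E \<subseteq> glue_coarse X f Y"

definition uniform_structure :: "'a set \<Rightarrow> ('a \<times> 'a) set set \<Rightarrow> bool" where
  "uniform_structure S \<U> \<longleftrightarrow>
     \<U> \<noteq> {} \<and> \<U> \<subseteq> Pow (S \<times> S) \<and>
     (\<forall>u\<in>\<U>. Id_on S \<subseteq> u) \<and>
     (\<forall>u\<in>\<U>. \<forall>v. u \<subseteq> v \<and> v \<subseteq> S \<times> S \<longrightarrow> v \<in> \<U>) \<and>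
     (\<forall>u\<in>\<U>. \<forall>v\<in>\<U>. u \<inter> v \<in> \<U>) \<and>
     (\<forall>u\<in>\<U>. u\<inverse> \<in> \<U>) \<and>
     (\<forall>u\<in>\<U>. \<exists>v\<in>\<U>. v O v \<subseteq> u)"

definition compatible_uniformity :: "'a topology \<Rightarrow> ('a \<times> 'a) set set \<Rightarrow> bool" where
  "compatible_uniformity T \<U> \<longleftrightarrow>
     uniform_structure (topspace T) \<U> \<and>
     (\<forall>U. openin T U \<longleftrightarrow> U \<subseteq> topspace T \<and> (\<forall>x\<in>U. \<exists>u\<in>\<U>. u `` {x} \<subseteq> U))"

definition extended_action ::
    "('g, 'm) monoid_scheme \<Rightarrow> 'x topology \<Rightarrow> ('g \<Rightarrow> 'x \<Rightarrow> 'x) \<Rightarrow> ('x set \<Rightarrow> 'y set) \<Rightarrow> 'y topology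
      \<Rightarrow> ('g \<Rightarrow> 'x + 'y \<Rightarrow> 'x + 'y) \<Rightarrow> bool" where
  "extended_action G X \<phi> f Y \<Phi> \<longleftrightarrow>
     action_by_homeos G (glue X f Y) \<Phi> \<and>
     (\<forall>g\<in>carrier G. \<forall>x\<in>topspace X. \<Phi> g (Inl x) = Inl (\<phi> g x))"

text \<open>A compact Hausdorff space has exactly one compatible uniformity, so the quantification over
  \<^term>\<open>\<U>\<close> below ranges over that single structure.\<close>

definition group_perspective ::
    "('g, 'm) monoid_scheme \<Rightarrow> 'x topology \<Rightarrow> ('g \<Rightarrow> 'x \<Rightarrow> 'x) \<Rightarrow> ('x set \<Rightarrow> 'y set) \<Rightarrow> 'y topology \<Rightarrow> bool" where
  "group_perspective G X \<phi> f Y \<longleftrightarrow>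
     (\<exists>\<Phi>. extended_action G X \<phi> f Y \<Phi>) \<and>
     (\<forall>\<U> u K. compatible_uniformity (glue X f Y) \<U> \<and> u \<in> \<U> \<and> compactin X K \<longrightarrow>
        finite {g \<in> carrier G. \<not> (Inl ` \<phi> g ` K) \<times> (Inl ` \<phi> g ` K) \<subseteq> u})"

section \<open>Categories and functors\<close>

text \<open>All categories here are concrete: composition and identities are those of functions, so a
  category is recorded by its objects and its hom-sets. A functor carries its domain, codomain and
  two maps, which \<open>make_functor\<close> makes extensional, so that equality of such records is
  equality of functors.\<close>

record ('o, 'a) concrete_cat =
  Obj :: "'o set"
  Mor :: "'o \<Rightarrow> 'o \<Rightarrow> 'a set"

record ('o, 'a, 'p, 'b) functor_data =
  Dom :: "('o, 'a) concrete_cat"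
  Cod :: "('p, 'b) concrete_cat"
  omap :: "'o \<Rightarrow> 'p"
  fmap :: "'o \<Rightarrow> 'o \<Rightarrow> 'a \<Rightarrow> 'b"

definition make_functor ::
    "('o, 'a) concrete_cat \<Rightarrow> ('p, 'b) concrete_cat \<Rightarrow> ('o \<Rightarrow> 'p) \<Rightarrow> ('o \<Rightarrow> 'o \<Rightarrow> 'a \<Rightarrow> 'b)
      \<Rightarrow> ('o, 'a, 'p, 'b) functor_data" where
  "make_functor C D F M =
     \<lparr>Dom = C, Cod = D, omap = restrict F (Obj C),
      fmap = (\<lambda>A\<in>Obj C. \<lambda>B\<in>Obj C. \<lambda>m\<in>Mor C A B. M A B m)\<rparr>"

definition restrict_functor ::
    "('o, 'a, 'p, 'b) functor_data \<Rightarrow> ('o, 'a) concrete_cat \<Rightarrow> ('o, 'a, 'p, 'b) functor_data" where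
  "restrict_functor F C = make_functor C (Cod F) (omap F) (fmap F)"

text \<open>Composition with the inclusion of the codomain into a larger category.\<close>

definition extend_codomain ::
    "('o, 'a, 'p, 'b) functor_data \<Rightarrow> ('p, 'b) concrete_cat \<Rightarrow> ('o, 'a, 'p, 'b) functor_data" where
  "extend_codomain F D = F\<lparr>Cod := D\<rparr>"

text \<open>The pair \<^term>\<open>(Y, f)\<close> stands for the compactification \<^term>\<open>glue X f Y\<close>.\<close>

type_synonym ('x, 'y) corona = "'y topology \<times> ('x set \<Rightarrow> 'y set)"

definition morphisms_over ::
    "'x topology \<Rightarrow> ('x, 'y) corona \<Rightarrow> ('x, 'y) corona \<Rightarrow> ('x + 'y \<Rightarrow> 'x + 'y) set" where
  "morphisms_over X = (\<lambda>(Y, f) (Z, h).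
     {m \<in> extensional (topspace (glue X f Y)).
        continuous_map (glue X f Y) (glue X h Z) m \<and> (\<forall>x\<in>topspace X. m (Inl x) = Inl x)})"

definition equivariant ::
    "('g, 'm) monoid_scheme \<Rightarrow> 'x topology \<Rightarrow> ('g \<Rightarrow> 'x \<Rightarrow> 'x) \<Rightarrow> ('x, 'y) corona \<Rightarrow> ('x, 'y) corona
      \<Rightarrow> ('x + 'y \<Rightarrow> 'x + 'y) \<Rightarrow> bool" where
  "equivariant G X \<phi> = (\<lambda>(Y, f) (Z, h) m.
     \<exists>\<Phi> \<Psi>. extended_action G X \<phi> f Y \<Phi> \<and> extended_action G X \<phi> h Z \<Psi> \<and>
       (\<forall>g\<in>carrier G. \<forall>p\<in>topspace (glue X f Y). m (\<Phi> g p) = \<Psi> g (m p)))"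

definition MPers ::
    "'x topology \<Rightarrow> ('x \<times> 'x) set set \<Rightarrow> (('x, 'y) corona, 'x + 'y \<Rightarrow> 'x + 'y) concrete_cat" where
  "MPers X E =
     \<lparr>Obj = {(Y, f). compactification X f Y \<and> metrizable_space (glue X f Y) \<and>
                     coarsely_perspective X E f Y},
      Mor = morphisms_over X\<rparr>"

definition EMPers0 ::
    "('g, 'm) monoid_scheme \<Rightarrow> 'x topology \<Rightarrow> ('g \<Rightarrow> 'x \<Rightarrow> 'x)
      \<Rightarrow> (('x, 'y) corona, 'x + 'y \<Rightarrow> 'x + 'y) concrete_cat" where
  "EMPers0 G X \<phi> =
     \<lparr>Obj = {(Y, f). compactification X f Y \<and> metrizable_space (glue X f Y) \<and>
                     group_perspective G X \<phi> f Y},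
      Mor = (\<lambda>A B. {m \<in> morphisms_over X A B. equivariant G X \<phi> A B m})\<rparr>"

definition EMPers0_group ::
    "('g, 'm) monoid_scheme \<Rightarrow> (('g, 'y) corona, 'g + 'y \<Rightarrow> 'g + 'y) concrete_cat" where
  "EMPers0_group G = EMPers0 G (group_top G) (left_mult G)"

text \<open>Sends \<open>id + \<beta>\<close> between compactifications of \<open>G\<close> to \<open>id + \<beta>\<close> between those of \<open>X\<close>.
  A morphism between Hausdorff compactifications that is the identity on the dense part maps
  boundary to boundary, so \<^const>\<open>projr\<close> recovers \<open>\<beta>\<close>.\<close>

definition transfer_morphism ::
    "'x topology \<Rightarrow> ('g, 'y) corona \<Rightarrow> ('g, 'y) corona \<Rightarrow> ('g + 'y \<Rightarrow> 'g + 'y) \<Rightarrow> ('x + 'y \<Rightarrow> 'x + 'y)" where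
  "transfer_morphism X A B m =
     restrict (map_sum id (\<lambda>y. projr (m (Inr y)))) (topspace X <+> topspace (fst A))"

text \<open>\<open>\<Pi>\<close>, for the fundamental domain \<open>K\<close>.\<close>

definition Pi_functor ::
    "('g, 'm) monoid_scheme \<Rightarrow> 'x topology \<Rightarrow> ('g \<Rightarrow> 'x \<Rightarrow> 'x) \<Rightarrow> 'x set
      \<Rightarrow> (('g, 'y) corona, 'g + 'y \<Rightarrow> 'g + 'y, ('x, 'y) corona, 'x + 'y \<Rightarrow> 'x + 'y) functor_data" where
  "Pi_functor G X \<phi> K =
     make_functor (EMPers0_group G) (EMPers0 G X \<phi>)
       (\<lambda>(Y, f). (Y, \<lambda>S\<in>Collect (closedin X). f {g \<in> carrier G. \<phi> g ` K \<inter> S \<noteq> {}}))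
       (transfer_morphism X)"

text \<open>\<open>\<Pi>'\<close>. Since \<open>G\<close> is discrete, \<^term>\<open>\<psi> ` S\<close> is closed.\<close>

definition pullback_functor ::
    "('g, 'm) monoid_scheme \<Rightarrow> 'x topology \<Rightarrow> ('g \<Rightarrow> 'x \<Rightarrow> 'x) \<Rightarrow> ('x \<Rightarrow> 'g)
      \<Rightarrow> (('g, 'y) corona, 'g + 'y \<Rightarrow> 'g + 'y, ('x, 'y) corona, 'x + 'y \<Rightarrow> 'x + 'y) functor_data" where
  "pullback_functor G X \<phi> \<psi> =
     make_functor (MPers (group_top G) (group_coarse G)) (MPers X (action_coarse G X \<phi>))
       (\<lambda>(Y, f). (Y, \<lambda>S\<in>Collect (closedin X). f (\<psi> ` S)))
       (transfer_morphism X)"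

end

theory Submission
  imports Defs
begin

text \<open>Write \<open>A\<^sub>S\<close> for the set of all \<open>g\<close> such that \<open>\<phi> g ` K\<close> meets \<open>S\<close>. The relation
  \<open>{(\<psi> s, g) | s \<in> S, s \<in> \<phi> g ` K}\<close> has domain \<open>\<psi> ` S\<close> and range \<open>A\<^sub>S\<close>. It is controlled in \<open>G\<close>:
  \<open>s\<close> and \<open>\<phi> g x0\<close> are \<open>Sat\<close>-related through \<open>insert x0 K\<close>, the map \<open>\<psi>\<close> is bornologous, and
  \<open>\<psi> (\<phi> g x0)\<close> is uniformly close to \<open>g\<close>. In a perspective compactification, two sets
  that are the projections of a controlled relation accumulate at the same boundary points, so
  \<open>f (\<psi> ` S) = f A\<^sub>S\<close>.
  That group perspectivity implies coarse perspectivity comes from splitting \<open>Sat A\<close>, for a given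
  entourage \<open>u\<close>, into finitely many compact squares inside \<open>X \<times> X\<close> and a part contained in \<open>u\<close>: no
  off-diagonal pair involving the boundary can be a limit of either part.\<close>

section \<open>Generated coarse structures\<close>

lemma coarse_structureD:
  assumes "coarse_structure S E"
  shows "E \<subseteq> Pow (S \<times> S)" "Id_on S \<in> E"
    and "\<And>e d. e \<in> E \<Longrightarrow> d \<subseteq> e \<Longrightarrow> d \<in> E"
    and "\<And>e d. e \<in> E \<Longrightarrow> d \<in> E \<Longrightarrow> e \<union> d \<in> E"
    and "\<And>e. e \<in> E \<Longrightarrow> e\<inverse> \<in> E"
    and "\<And>e d. e \<in> E \<Longrightarrow> d \<in> E \<Longrightarrow> e O d \<in> E"
  using assms unfolding coarse_structure_def by simp_all

lemma coarse_structure_Pow: "coarse_structure S (Pow (S \<times> S))"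
  unfolding coarse_structure_def by (intro conjI ballI allI impI PowI) (auto simp: Id_on_def)

text \<open>All the closure properties of a coarse structure pass to intersections. The hypothesis
  makes \<open>Pow (S \<times> S)\<close> a member of the intersected family, which keeps the
  intersection inside it.\<close>

lemma coarse_structure_generated:
  assumes "B \<subseteq> Pow (S \<times> S)"
  shows "coarse_structure S (coarse_generated S B)"
proof -
  have mem: "e \<in> coarse_generated S B \<longleftrightarrow> (\<forall>E. coarse_structure S E \<longrightarrow> B \<subseteq> E \<longrightarrow> e \<in> E)" for e
    unfolding coarse_generated_def by auto
  show ?thesis
    unfolding coarse_structure_def
  proof (intro conjI ballI allI impI)
    show "coarse_generated S B \<subseteq> Pow (S \<times> S)"
      unfolding coarse_generated_def
      by (rule Inter_lower) (simp add: assms coarse_structure_Pow)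
  qed (simp_all add: mem coarse_structureD(2,4-6), metis coarse_structureD(3))
qed

lemma coarse_generated_least:
  assumes "coarse_structure S E" "B \<subseteq> E"
  shows "coarse_generated S B \<subseteq> E"
  using assms unfolding coarse_generated_def by blast

lemma Sat_subset:
  assumes "\<And>g. g \<in> carrier G \<Longrightarrow> \<phi> g ` S \<subseteq> S" "A \<subseteq> S"
  shows "Sat G \<phi> A \<subseteq> S \<times> S"
  using assms unfolding Sat_def by blast

lemma coarse_structure_action_coarse:
  assumes "\<And>g. g \<in> carrier G \<Longrightarrow> \<phi> g ` topspace X \<subseteq> topspace X"
  shows "coarse_structure (topspace X) (action_coarse G X \<phi>)"
  unfolding action_coarse_def
proof (rule coarse_structure_generated, clarify)
  fix A x y assume "topologically_bounded X A" "(x, y) \<in> Sat G \<phi> A"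
  then show "x \<in> topspace X \<and> y \<in> topspace X"
    using Sat_subset[of G \<phi> "topspace X" A] assms unfolding topologically_bounded_def by blast
qed

lemma Sat_in_action_coarse:
  assumes "topologically_bounded X A"
  shows "Sat G \<phi> A \<in> action_coarse G X \<phi>"
  using assms unfolding action_coarse_def coarse_generated_def by blast

section \<open>Closed relations on compact Hausdorff spaces\<close>

text \<open>A closed subset of the compact square is compact, hence so is its projection, and
  compact sets are closed in a Hausdorff space.\<close>

lemma closedin_Domain:
  assumes T: "compact_space T" "Hausdorff_space T" and C: "closedin (prod_topology T T) C"
  shows "closedin T (Domain C)"
proof -
  have "compact_space (prod_topology T T)" by (simp add: compact_space_prod_topology T)
  then have "compactin (prod_topology T T) C" using C by (rule closedin_compact_space)
  then have "compactin T (fst ` C)" using continuous_map_fst by (rule image_compactin)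
  then show ?thesis
    unfolding Domain_fst by (rule compactin_imp_closedin[OF T(2)])
qed

lemma closedin_converse:
  assumes "closedin (prod_topology T T) C"
  shows "closedin (prod_topology T T) (C\<inverse>)"
proof -
  have eq: "C\<inverse> = {z \<in> topspace (prod_topology T T). (snd z, fst z) \<in> C}"
    using closedin_subset[OF assms] by auto
  show ?thesis
    unfolding eq by (rule closedin_continuous_map_preimage[OF _ assms])
      (intro continuous_map_pairedI continuous_map_fst continuous_map_snd)
qed

text \<open>The composition is the image, under the projection forgetting the middle coordinate, of
  a closed and hence compact subset of the triple product.\<close>

lemma closedin_relcomp:
  assumes T: "compact_space T" "Hausdorff_space T"
    and C: "closedin (prod_topology T T) C" and D: "closedin (prod_topology T T) D"
  shows "closedin (prod_topology T T) (C O D)"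
proof -
  let ?T3 = "prod_topology T (prod_topology T T)"
  let ?\<pi>12 = "\<lambda>z. (fst z, (fst \<circ> snd) z)" and ?\<pi>13 = "\<lambda>z. (fst z, (snd \<circ> snd) z)"
  let ?P = "{z \<in> topspace ?T3. ?\<pi>12 z \<in> C} \<inter> {z \<in> topspace ?T3. snd z \<in> D}"
  have "continuous_map ?T3 T (fst \<circ> snd)" "continuous_map ?T3 T (snd \<circ> snd)"
    using continuous_map_compose[OF continuous_map_snd continuous_map_fst]
      continuous_map_compose[OF continuous_map_snd continuous_map_snd] by blast+
  then have cont: "continuous_map ?T3 (prod_topology T T) ?\<pi>12"
    "continuous_map ?T3 (prod_topology T T) ?\<pi>13"
    using continuous_map_fst by (blast intro: continuous_map_pairedI)+
  have "closedin ?T3 ?P"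
    by (intro closedin_Int closedin_continuous_map_preimage[OF cont(1) C]
        closedin_continuous_map_preimage[OF continuous_map_snd D])
  then have "compactin ?T3 ?P"
    by (rule closedin_compact_space[rotated]) (simp add: compact_space_prod_topology T)
  then have "compactin (prod_topology T T) (?\<pi>13 ` ?P)"
    using cont(2) by (rule image_compactin)
  moreover have "?\<pi>13 ` ?P = C O D"
  proof (intro equalityI subsetI)
    fix w assume "w \<in> C O D"
    then obtain x y z where w: "w = (x, z)" "(x, y) \<in> C" "(y, z) \<in> D" by blast
    then have "(x, y, z) \<in> ?P"
      using closedin_subset[OF C] closedin_subset[OF D] by auto
    then show "w \<in> ?\<pi>13 ` ?P" using w(1) by (intro image_eqI[of _ _ "(x, y, z)"]) auto
  qed auto
  ultimately have "compactin (prod_topology T T) (C O D)"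
    by (simp only:)
  then show ?thesis
    by (rule compactin_imp_closedin[rotated]) (simp add: Hausdorff_space_prod_topology T)
qed

section \<open>The coarse structure of a compactification\<close>

text \<open>Identifies \<open>f A\<close> with the set of boundary points adherent to
  \<open>A\<close>, so that claims about admissible maps become claims about closures in the glued
  space.\<close>

lemma glue_closure_of_Inl:
  assumes f: "admissible X Y f" and A: "closedin X A"
  shows "glue X f Y closure_of (Inl ` A) = A <+> f A"
proof (rule closure_of_unique)
  show "Inl ` A \<subseteq> A <+> f A" by auto
  have v: "Inl -` (A <+> f A) = A" "Inr -` (A <+> f A) = f A" by auto
  have "closedin Y (f A)" using f A by (auto simp: admissible_def)
  then show "closedin (glue X f Y) (A <+> f A)"
    using A by (simp add: closedin_glue[OF f] glue_closed_def v)
  fix C assume C: "Inl ` A \<subseteq> C" "closedin (glue X f Y) C"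
  then have "f A \<subseteq> f (Inl -` C)"
    using A by (intro admissible_mono[OF f]) (auto simp: closedin_glue[OF f] glue_closed_def)
  with C show "A <+> f A \<subseteq> C"
    by (auto simp: closedin_glue[OF f] glue_closed_def)
qed

lemma continuous_map_Inl_glue:
  assumes "admissible X Y f"
  shows "continuous_map X (glue X f Y) Inl"
proof -
  have "{x \<in> topspace X. Inl x \<in> C} = Inl -` C" if "closedin X (Inl -` C)" for C :: "('a + 'b) set"
    using closedin_subset[OF that] by auto
  then show ?thesis
    by (auto simp: continuous_map_closedin closedin_glue[OF assms] topspace_glue[OF assms]
        glue_closed_def)
qed

text \<open>On the glued space the right-hand bound is the equivalence relation that identifies the
  points of \<open>X\<close> with one another. In this form it is visibly stable under inverses and
  compositions.\<close>

lemma glue_coarse_iff: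
  assumes f: "admissible X Y f"
  shows "e \<in> glue_coarse X f Y \<longleftrightarrow> e \<subseteq> topspace X \<times> topspace X \<and>
    prod_topology (glue X f Y) (glue X f Y) closure_of (map_prod Inl Inl ` e) \<subseteq>
      Id \<union> Inl ` topspace X \<times> Inl ` topspace X"
    (is "_ \<longleftrightarrow> _ \<and> ?cl \<subseteq> _")
proof -
  let ?S = "topspace X <+> topspace Y" and ?I = "Inl ` topspace X"
    and ?\<Delta> = "{(Inr w, Inr w) | w. w \<in> topspace Y}"
  have "?cl \<subseteq> topspace (glue X f Y) \<times> topspace (glue X f Y)"
    using closure_of_subset_topspace by fastforce
  then have cl: "?cl \<subseteq> ?S \<times> ?S"
    by (simp add: topspace_glue[OF f])
  \<comment> \<open>Pairs inside \<open>X\<close> satisfy both sides, mixed pairs satisfy neither,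
    and for two boundary points both sides express equality.\<close>
  have "((p, q) \<in> ?S \<times> ?S - ?I \<times> ?I \<longrightarrow> (p, q) \<in> ?\<Delta>) \<longleftrightarrow> (p, q) \<in> Id \<union> ?I \<times> ?I"
    if "(p, q) \<in> ?S \<times> ?S" for p q
    using that by (cases p; cases q) auto
  then have pt: "(z \<in> ?S \<times> ?S - ?I \<times> ?I \<longrightarrow> z \<in> ?\<Delta>) \<longleftrightarrow> z \<in> Id \<union> ?I \<times> ?I"
    if "z \<in> ?S \<times> ?S" for z
    using that by (cases z) simp
  have "?cl \<inter> (?S \<times> ?S - ?I \<times> ?I) \<subseteq> ?\<Delta> \<longleftrightarrow>
      (\<forall>z. z \<in> ?cl \<longrightarrow> (z \<in> ?S \<times> ?S - ?I \<times> ?I \<longrightarrow> z \<in> ?\<Delta>))"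
    unfolding subset_iff Int_iff by blast
  also have "\<dots> \<longleftrightarrow> ?cl \<subseteq> Id \<union> ?I \<times> ?I"
    unfolding subset_iff by (intro all_cong1 imp_cong refl pt) (rule subsetD[OF cl])
  finally show ?thesis
    by (simp only: glue_coarse_def topspace_glue[OF f] mem_Collect_eq)
qed

text \<open>Converses and compositions of closed relations are closed, so the closure of
  \<open>e O d\<close> lies in \<open>cl e O cl d\<close>, and likewise for converses. Symmetry and
  transitivity of \<open>R\<close> then keep these closures inside \<open>R\<close>.\<close>

lemma coarse_structure_glue_coarse:
  assumes f: "admissible X Y f" and T: "compact_space (glue X f Y)" "Hausdorff_space (glue X f Y)"
  shows "coarse_structure (topspace X) (glue_coarse X f Y)"
proof -
  let ?T = "glue X f Y" and ?X = "topspace X"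
    and ?N = "map_prod Inl Inl :: 'a \<times> 'a \<Rightarrow> ('a + 'b) \<times> ('a + 'b)"
  define R :: "(('a + 'b) \<times> ('a + 'b)) set" where "R = Id \<union> Inl ` ?X \<times> Inl ` ?X"
  define cl where "cl e = prod_topology ?T ?T closure_of (?N ` e)" for e :: "('a \<times> 'a) set"
  have iff: "e \<in> glue_coarse X f Y \<longleftrightarrow> e \<subseteq> ?X \<times> ?X \<and> cl e \<subseteq> R" for e
    unfolding cl_def R_def by (rule glue_coarse_iff[OF f])
  have clos: "closedin (prod_topology ?T ?T) (cl e)" for e
    unfolding cl_def by (rule closedin_closure_of)
  have inc: "?N ` e \<subseteq> cl e" if "e \<subseteq> ?X \<times> ?X" for e
    unfolding cl_def using that by (intro closure_of_subset) (auto simp: topspace_glue[OF f])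
  have minimal: "cl e \<subseteq> C" if "?N ` e \<subseteq> C" "closedin (prod_topology ?T ?T) C" for e C
    unfolding cl_def using that by (rule closure_of_minimal)
  show ?thesis
    unfolding coarse_structure_def
  proof (intro conjI ballI allI impI)
    show "glue_coarse X f Y \<subseteq> Pow (?X \<times> ?X)" by (auto simp: glue_coarse_def)
    \<comment> \<open>The diagonal of a Hausdorff space is closed, so the closure of the diagonal of
      \<open>X\<close> acquires no off-diagonal pairs.\<close>
    have "closedin (prod_topology ?T ?T) ((\<lambda>x. (x, x)) ` topspace ?T)"
      using T(2) by (simp add: Hausdorff_space_closedin_diagonal)
    then have "cl (Id_on ?X) \<subseteq> (\<lambda>x. (x, x)) ` topspace ?T"
      by (rule minimal[rotated]) (auto simp: topspace_glue[OF f])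
    also have "\<dots> \<subseteq> R" unfolding R_def by blast
    finally show "Id_on ?X \<in> glue_coarse X f Y" unfolding iff by blast
  next
    fix e d assume "e \<in> glue_coarse X f Y" "d \<subseteq> e"
    moreover have "cl d \<subseteq> cl e"
      unfolding cl_def using \<open>d \<subseteq> e\<close> by (intro closure_of_mono image_mono)
    ultimately show "d \<in> glue_coarse X f Y" unfolding iff by blast
  next
    fix e d assume "e \<in> glue_coarse X f Y" "d \<in> glue_coarse X f Y"
    moreover have "cl (e \<union> d) = cl e \<union> cl d"
      unfolding cl_def image_Un by (rule closure_of_Un)
    ultimately show "e \<union> d \<in> glue_coarse X f Y" unfolding iff by simp
  next
    fix e assume "e \<in> glue_coarse X f Y"
    then have e: "e \<subseteq> ?X \<times> ?X" "cl e \<subseteq> R" unfolding iff by auto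
    have "?N ` (e\<inverse>) \<subseteq> (cl e)\<inverse>" using inc[OF e(1)] by auto
    then have "cl (e\<inverse>) \<subseteq> (cl e)\<inverse>" using closedin_converse[OF clos] by (rule minimal)
    also have "\<dots> \<subseteq> R\<inverse>" using e(2) by blast
    also have "\<dots> = R" unfolding R_def by blast
    finally show "e\<inverse> \<in> glue_coarse X f Y" using e(1) unfolding iff by blast
  next
    fix e d assume "e \<in> glue_coarse X f Y" "d \<in> glue_coarse X f Y"
    then have e: "e \<subseteq> ?X \<times> ?X" "cl e \<subseteq> R" and d: "d \<subseteq> ?X \<times> ?X" "cl d \<subseteq> R"
      unfolding iff by auto
    have "?N ` (e O d) \<subseteq> ?N ` e O ?N ` d" by force
    also have "\<dots> \<subseteq> cl e O cl d" using inc[OF e(1)] inc[OF d(1)] by (rule relcomp_mono)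
    finally have "cl (e O d) \<subseteq> cl e O cl d"
      using closedin_relcomp[OF T clos clos] by (rule minimal)
    also have "\<dots> \<subseteq> R O R" using e(2) d(2) by (rule relcomp_mono)
    also have "\<dots> \<subseteq> R" unfolding R_def by blast
    finally show "e O d \<in> glue_coarse X f Y" using e(1) d(1) unfolding iff by blast
  qed
qed

text \<open>A boundary point adherent to the domain of \<open>e\<close> is the first coordinate of a
  pair in the closure of \<open>e\<close>. This pair must be diagonal, so the same point is adherent
  to the range of \<open>e\<close>.\<close>

lemma glue_coarse_boundary_subset:
  assumes f: "admissible X Y f" and T: "compact_space (glue X f Y)" "Hausdorff_space (glue X f Y)"
    and e: "e \<in> glue_coarse X f Y" and A: "closedin X (Domain e)"
    and B: "closedin X B" "Range e \<subseteq> B"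
  shows "f (Domain e) \<subseteq> f B"
proof
  fix w assume w: "w \<in> f (Domain e)"
  let ?T = "glue X f Y"
  define cl where "cl = prod_topology ?T ?T closure_of (map_prod Inl Inl ` e)"
  have eX: "e \<subseteq> topspace X \<times> topspace X" and cl: "cl \<subseteq> Id \<union> Inl ` topspace X \<times> Inl ` topspace X"
    using e unfolding glue_coarse_iff[OF f] cl_def by auto
  have "map_prod Inl Inl ` e \<subseteq> cl"
    unfolding cl_def using eX by (intro closure_of_subset) (auto simp: topspace_glue[OF f])
  then have "Inl ` Domain e \<subseteq> Domain cl" by fastforce
  \<comment> \<open>Closedness of this projection, which rests on compactness, is what provides a
    partner \<open>q\<close> for \<open>Inr w\<close>.\<close>
  moreover have "closedin ?T (Domain cl)"
    unfolding cl_def by (intro closedin_Domain T closedin_closure_of)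
  ultimately have "?T closure_of (Inl ` Domain e) \<subseteq> Domain cl" by (rule closure_of_minimal)
  moreover have "Inr w \<in> ?T closure_of (Inl ` Domain e)"
    using w unfolding glue_closure_of_Inl[OF f A] by (rule InrI)
  ultimately obtain q where q: "(Inr w, q) \<in> cl" by blast
  \<comment> \<open>\<open>Inr w\<close> lies outside the copy of \<open>X\<close>, so only the
    \<open>Id\<close> part of the bound can contain the pair, and \<open>q = Inr w\<close>.\<close>
  then have "(Inr w, Inr w) \<in> cl" using cl by auto
  moreover have "cl \<subseteq> (?T closure_of (Inl ` Domain e)) \<times> (?T closure_of (Inl ` B))"
    unfolding cl_def closure_of_Times[symmetric] using B(2) by (intro closure_of_mono) auto
  ultimately have "Inr w \<in> ?T closure_of (Inl ` B)" by blast
  then show "w \<in> f B" unfolding glue_closure_of_Inl[OF f B(1)] by auto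
qed

section \<open>Group perspectivity implies coarse perspectivity\<close>

text \<open>Supplies the metric uniformity, at which the quantifier over uniformities in
  \<open>group_perspective\<close> is instantiated.\<close>

lemma (in Metric_space) compatible_uniformity_mtopology:
  "compatible_uniformity mtopology
     {u. u \<subseteq> M \<times> M \<and> (\<exists>r>0. {(x, y). x \<in> M \<and> y \<in> M \<and> d x y < r} \<subseteq> u)}"
proof -
  define E where "E r = {(x, y). x \<in> M \<and> y \<in> M \<and> d x y < r}" for r
  define \<U> where "\<U> = {u. u \<subseteq> M \<times> M \<and> (\<exists>r>0. E r \<subseteq> u)}"
  have mem: "u \<in> \<U> \<longleftrightarrow> u \<subseteq> M \<times> M \<and> (\<exists>r>0. E r \<subseteq> u)" for u
    unfolding \<U>_def by simp
  have EM: "E r \<subseteq> M \<times> M" for r unfolding E_def by blast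
  have E_in: "E r \<in> \<U>" if "r > 0" for r
    unfolding mem using that EM by blast
  have E_Image: "E r `` {x} = mball x r" for r x
    unfolding E_def by auto
  have unif: "uniform_structure M \<U>"
    unfolding uniform_structure_def
  proof (intro conjI ballI allI impI)
    show "\<U> \<noteq> {}" using E_in[of 1] by auto
    show "\<U> \<subseteq> Pow (M \<times> M)" unfolding \<U>_def by blast
  next
    fix u assume "u \<in> \<U>"
    then obtain r where "r > 0" "E r \<subseteq> u" unfolding mem by blast
    moreover from \<open>r > 0\<close> have "Id_on M \<subseteq> E r" unfolding E_def by auto
    ultimately show "Id_on M \<subseteq> u" by blast
  next
    fix u v assume "u \<in> \<U>" and v: "u \<subseteq> v \<and> v \<subseteq> M \<times> M"
    then obtain r where "r > 0" "E r \<subseteq> u" unfolding mem by blast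
    with v show "v \<in> \<U>" unfolding mem by blast
  next
    fix u v assume u: "u \<in> \<U>" and v: "v \<in> \<U>"
    obtain r where r: "r > 0" "E r \<subseteq> u" using u unfolding mem by blast
    obtain s where s: "s > 0" "E s \<subseteq> v" using v unfolding mem by blast
    have "E (min r s) \<subseteq> E r" "E (min r s) \<subseteq> E s" unfolding E_def by auto
    then have "E (min r s) \<subseteq> u \<inter> v" using r(2) s(2) by blast
    moreover have "min r s > 0" using r(1) s(1) by simp
    moreover have "u \<inter> v \<subseteq> M \<times> M" using u unfolding mem by blast
    ultimately show "u \<inter> v \<in> \<U>" unfolding mem by blast
  next
    fix u assume u: "u \<in> \<U>"
    then obtain r where r: "r > 0" "E r \<subseteq> u" unfolding mem by blast
    have "(y, x) \<in> E r" if "(x, y) \<in> E r" for x y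
      using that commute[of x y] unfolding E_def by simp
    then have "E r \<subseteq> u\<inverse>" using r(2) by (intro subrelI) blast
    moreover have "u\<inverse> \<subseteq> M \<times> M" using u unfolding mem by blast
    ultimately show "u\<inverse> \<in> \<U>" unfolding mem using r(1) by blast
  next
    fix u assume "u \<in> \<U>"
    then obtain r where r: "r > 0" "E r \<subseteq> u" unfolding mem by blast
    have "E (r / 2) O E (r / 2) \<subseteq> E r"
    proof
      fix w assume "w \<in> E (r / 2) O E (r / 2)"
      then obtain x y z where w: "w = (x, z)" and xyz: "x \<in> M" "y \<in> M" "z \<in> M"
          "d x y < r / 2" "d y z < r / 2"
        unfolding E_def by blast
      then have "d x z < r" using triangle[of x y z] by linarith
      then show "w \<in> E r" unfolding E_def w using xyz by blast
    qed
    then have "E (r / 2) O E (r / 2) \<subseteq> u" using r(2) by (rule subset_trans)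
    moreover have "E (r / 2) \<in> \<U>" using r(1) by (intro E_in) simp
    ultimately show "\<exists>v\<in>\<U>. v O v \<subseteq> u" by (rule bexI)
  qed
  have ball: "(\<exists>r>0. mball x r \<subseteq> U) \<longleftrightarrow> (\<exists>u\<in>\<U>. u `` {x} \<subseteq> U)" for x U
  proof
    assume "\<exists>r>0. mball x r \<subseteq> U"
    then obtain r where r: "r > 0" "mball x r \<subseteq> U" by blast
    have "E r `` {x} \<subseteq> U" unfolding E_Image by (rule r(2))
    then show "\<exists>u\<in>\<U>. u `` {x} \<subseteq> U" using E_in[OF r(1)] by (rule bexI)
  next
    assume "\<exists>u\<in>\<U>. u `` {x} \<subseteq> U"
    then obtain u where u: "u \<in> \<U>" "u `` {x} \<subseteq> U" by (rule bexE)
    from u(1) obtain r where r: "r > 0" "E r \<subseteq> u" unfolding mem by blast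
    then have "mball x r \<subseteq> U" unfolding E_Image[symmetric] using u(2) by blast
    then show "\<exists>r>0. mball x r \<subseteq> U" using r(1) by blast
  qed
  have "compatible_uniformity mtopology \<U>"
    unfolding compatible_uniformity_def openin_mtopology topspace_mtopology ball
    by (intro conjI allI unif refl iffI) auto
  then show ?thesis unfolding \<U>_def E_def .
qed

text \<open>The entourage \<open>u\<close> depends on the off-diagonal limit pair
  \<open>(p, q)\<close>: it is so small that \<open>(p, q)\<close> is not in its closure. The pair
  must then come from the finitely many translates that are not \<open>u\<close>-small.\<close>

lemma Sat_in_glue_coarse:
  assumes f: "admissible X Y f" and met: "metrizable_space (glue X f Y)"
    and pers: "group_perspective G X \<phi> f Y"
    and cont: "\<And>g. g \<in> carrier G \<Longrightarrow> continuous_map X X (\<phi> g)"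
    and A: "topologically_bounded X A"
  shows "Sat G \<phi> A \<in> glue_coarse X f Y"
proof -
  \<comment> \<open>Group perspectivity speaks of compact sets, so \<open>A\<close> is replaced by
    its compact closure.\<close>
  define L where "L = X closure_of A"
  have AX: "A \<subseteq> topspace X" and L: "compactin X L"
    using A unfolding topologically_bounded_def L_def by simp_all
  have AL: "A \<subseteq> L" unfolding L_def using AX by (rule closure_of_subset)
  have LX: "L \<subseteq> topspace X" unfolding L_def by (rule closure_of_subset_topspace)
  let ?T = "glue X f Y" and ?I = "Inl ` topspace X"
  obtain M d where "Metric_space M d" and Td: "?T = Metric_space.mtopology M d"
    using met unfolding metrizable_space_def by blast
  then interpret Metric_space M d by simp
  define B :: "_ \<Rightarrow> ('a + 'b) set" where "B g = Inl ` \<phi> g ` L" for g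
  have fin: "finite {g \<in> carrier G. \<not> B g \<times> B g \<subseteq> u}"
    if "compatible_uniformity ?T \<U>" "u \<in> \<U>" for \<U> u
    unfolding B_def
    by (rule pers[unfolded group_perspective_def, THEN conjunct2, rule_format,
          OF conjI[OF that(1) conjI[OF that(2) L]]])
  have clos: "closedin ?T (B g)" if "g \<in> carrier G" for g
    unfolding B_def
    by (intro compactin_imp_closedin metrizable_imp_Hausdorff_space met
        image_compactin[OF _ continuous_map_Inl_glue[OF f]] image_compactin[OF _ cont] L that)
  have \<phi>X: "\<phi> g ` topspace X \<subseteq> topspace X" if "g \<in> carrier G" for g
    using cont[OF that] by (rule continuous_map_image_subset_topspace)
  then have BI: "B g \<subseteq> ?I" if "g \<in> carrier G" for g
    unfolding B_def using LX that by (meson image_mono subset_trans)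
  define S :: "(('a + 'b) \<times> ('a + 'b)) set" where "S = map_prod Inl Inl ` Sat G \<phi> A"
  have S: "\<exists>g\<in>carrier G. z \<in> B g \<times> B g" if "z \<in> S" for z
    using that AL unfolding S_def Sat_def B_def by auto
  have "p \<in> ?I \<and> q \<in> ?I"
    if "p \<noteq> q" and pq: "(p, q) \<in> prod_topology ?T ?T closure_of S" for p q
  proof -
    have "(p, q) \<in> topspace (prod_topology ?T ?T)"
      using pq closure_of_subset_topspace by (rule subsetD[rotated])
    then have pqM: "p \<in> M" "q \<in> M" unfolding Td by simp_all
    \<comment> \<open>A pair of points less than \<open>r\<close> apart, with coordinates within
      \<open>r\<close> of \<open>p\<close> and \<open>q\<close>, would give
      \<open>d p q < 3 * r\<close>. This contradicts the choice of \<open>r\<close>.\<close>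
    define r where "r = d p q / 3"
    have r: "r > 0" using \<open>p \<noteq> q\<close> pqM by (simp add: r_def)
    define u where "u = {(x, y). x \<in> M \<and> y \<in> M \<and> d x y < r}"
    have "u \<in> {u. u \<subseteq> M \<times> M \<and> (\<exists>r>0. {(x, y). x \<in> M \<and> y \<in> M \<and> d x y < r} \<subseteq> u)}"
      using r unfolding u_def by blast
    define F where "F = {g \<in> carrier G. \<not> B g \<times> B g \<subseteq> u}"
    have "finite F"
      unfolding F_def by (rule fin[OF compatible_uniformity_mtopology[folded Td]]) fact
    \<comment> \<open>Being a finite union of closed squares, this part of the cover has no limit
      pairs outside itself, hence none outside the square of \<open>X\<close>.\<close>
    then have closP: "closedin (prod_topology ?T ?T) (\<Union>g\<in>F. B g \<times> B g)"
      using clos by (intro closedin_Union) (auto simp: F_def closedin_prod_Times_iff)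
    have "(p, q) \<notin> prod_topology ?T ?T closure_of u"
    proof
      assume cl: "(p, q) \<in> prod_topology ?T ?T closure_of u"
      have op: "openin (prod_topology ?T ?T) (mball p r \<times> mball q r)"
        unfolding Td openin_prod_Times_iff by simp
      have "(p, q) \<in> mball p r \<times> mball q r" using pqM r by simp
      then have "\<exists>z. z \<in> u \<and> z \<in> mball p r \<times> mball q r"
        by (rule cl[unfolded in_closure_of, THEN conjunct2, THEN spec, THEN mp, OF conjI[OF _ op]])
      then obtain z where "z \<in> u" "z \<in> mball p r \<times> mball q r" by (elim exE conjE)
      then obtain x y where "x \<in> M" "y \<in> M" "d x y < r" "d p x < r" "d q y < r"
        unfolding u_def by auto
      moreover have "d y q = d q y" by (rule commute)
      moreover have "d p q \<le> d p x + d x q" "d x q \<le> d x y + d y q"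
        using \<open>x \<in> M\<close> \<open>y \<in> M\<close> pqM by (simp_all add: triangle)
      ultimately show False unfolding r_def by linarith
    qed
    moreover have "S \<subseteq> (\<Union>g\<in>F. B g \<times> B g) \<union> u"
    proof
      fix z assume "z \<in> S"
      then obtain g where "g \<in> carrier G" "z \<in> B g \<times> B g" using S by blast
      then show "z \<in> (\<Union>g\<in>F. B g \<times> B g) \<union> u" unfolding F_def by blast
    qed
    then have "(p, q) \<in> prod_topology ?T ?T closure_of ((\<Union>g\<in>F. B g \<times> B g) \<union> u)"
      using pq closure_of_mono by blast
    ultimately have "(p, q) \<in> (\<Union>g\<in>F. B g \<times> B g)"
      unfolding closure_of_Un closure_of_closedin[OF closP] by blast
    then show "p \<in> ?I \<and> q \<in> ?I"
      using BI unfolding F_def by blast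
  qed
  then have "prod_topology ?T ?T closure_of S \<subseteq> Id \<union> ?I \<times> ?I"
    by (intro subrelI) blast
  moreover have "Sat G \<phi> A \<subseteq> topspace X \<times> topspace X"
    using \<phi>X AX by (rule Sat_subset)
  ultimately show ?thesis unfolding glue_coarse_iff[OF f] S_def by blast
qed

text \<open>Since \<open>glue_coarse X f Y\<close> is itself a coarse structure, it suffices to test
  the generators \<open>Sat G \<phi> A\<close>.\<close>

lemma group_perspective_imp_coarsely_perspective:
  assumes "compactification X f Y" "metrizable_space (glue X f Y)" "group_perspective G X \<phi> f Y"
    and "\<And>g. g \<in> carrier G \<Longrightarrow> continuous_map X X (\<phi> g)"
  shows "coarsely_perspective X (action_coarse G X \<phi>) f Y"
  unfolding coarsely_perspective_def action_coarse_def
  using assms unfolding compactification_def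
  by (intro coarse_generated_least coarse_structure_glue_coarse)
    (auto intro!: Sat_in_glue_coarse)

lemma (in group) continuous_map_left_mult:
  assumes "g \<in> carrier G"
  shows "continuous_map (group_top G) (group_top G) (left_mult G g)"
  using assms by (auto simp: group_top_def left_mult_def)

text \<open>Places the objects to which the pullback functor is restricted inside its domain, and
  makes coarse perspectivity available for them.\<close>

lemma (in group) Obj_EMPers0_group_subset:
  "Obj (EMPers0_group G) \<subseteq> Obj (MPers (group_top G) (group_coarse G))"
  unfolding EMPers0_group_def EMPers0_def MPers_def group_coarse_def
  by (auto intro: group_perspective_imp_coarsely_perspective continuous_map_left_mult)

lemma (in group) coarse_structure_group_coarse: "coarse_structure (carrier G) (group_coarse G)"
  using coarse_structure_action_coarse[of G "left_mult G" "group_top G"]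
  by (auto simp: group_coarse_def group_top_def left_mult_def)

section \<open>Comparison of the two functors\<close>

lemma (in group) coarse_inverse_fundamental_domain:
  assumes X: "Hausdorff_space X" and x0: "x0 \<in> topspace X" and K: "compactin X K"
    and \<psi>: "coarse_inverse (carrier G) (group_coarse G) (topspace X) (action_coarse G X \<phi>)
           (\<lambda>g. \<phi> g x0) \<psi>"
  shows "{(\<psi> s, g) | s g. s \<in> topspace X \<and> g \<in> carrier G \<and> s \<in> \<phi> g ` K} \<in> group_coarse G"
    (is "?e \<in> _")
proof -
  \<comment> \<open>Adding \<open>x0\<close> to \<open>K\<close> puts \<open>\<phi> g k\<close> and
    \<open>\<phi> g x0\<close> into one translate of a single compact set; \<open>?c\<close> then
    leads from \<open>\<psi> (\<phi> g x0)\<close> back to \<open>g\<close>.\<close>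
  let ?d = "map_prod \<psi> \<psi> ` Sat G \<phi> (insert x0 K)"
  let ?c = "{(\<psi> (\<phi> g x0), g) | g. g \<in> carrier G}"
  have "compactin X (insert x0 K)"
    using compactin_Un[OF _ K, of "{x0}"] x0 by simp
  then have "topologically_bounded X (insert x0 K)"
    unfolding topologically_bounded_def
    using closure_of_closedin[OF compactin_imp_closedin[OF X]] compactin_subset_topspace by metis
  then have "?d \<in> group_coarse G"
    using \<psi> Sat_in_action_coarse[of X "insert x0 K" G \<phi>]
    by (auto simp: coarse_inverse_def coarse_map_def bornologous_def)
  moreover have "?c \<in> group_coarse G"
    using \<psi> by (simp add: coarse_inverse_def close_maps_def)
  ultimately have "?d O ?c \<in> group_coarse G"
    using coarse_structure_group_coarse by (simp add: coarse_structure_def)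
  moreover have "?e \<subseteq> ?d O ?c"
  proof clarify
    fix k g assume g: "g \<in> carrier G" and k: "k \<in> K"
    then have "(\<phi> g k, \<phi> g x0) \<in> Sat G \<phi> (insert x0 K)" unfolding Sat_def by blast
    then have "(\<psi> (\<phi> g k), \<psi> (\<phi> g x0)) \<in> ?d" by force
    moreover have "(\<psi> (\<phi> g x0), g) \<in> ?c" using g by blast
    ultimately show "(\<psi> (\<phi> g k), g) \<in> ?d O ?c" by (rule relcompI)
  qed
  ultimately show ?thesis
    using coarse_structure_group_coarse unfolding coarse_structure_def by blast
qed

text \<open>The two inclusions come from applying \<open>glue_coarse_boundary_subset\<close> to
  \<open>e\<close> and to its converse. Domain and range are closed because \<open>G\<close> is
  discrete.\<close>

lemma (in group) pullback_boundary_eq: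
  assumes X: "Hausdorff_space X" and x0: "x0 \<in> topspace X" and K: "compactin X K"
    and cov: "(\<Union>g\<in>carrier G. \<phi> g ` K) = topspace X"
    and \<psi>: "coarse_inverse (carrier G) (group_coarse G) (topspace X) (action_coarse G X \<phi>)
           (\<lambda>g. \<phi> g x0) \<psi>"
    and Yf: "(Y, f) \<in> Obj (MPers (group_top G) (group_coarse G))" and S: "closedin X S"
  shows "f (\<psi> ` S) = f {g \<in> carrier G. \<phi> g ` K \<inter> S \<noteq> {}}"
proof -
  have f: "admissible (group_top G) Y f" and T: "compact_space (glue (group_top G) f Y)"
    "Hausdorff_space (glue (group_top G) f Y)"
    and pers: "group_coarse G \<subseteq> glue_coarse (group_top G) f Y"
    using Yf by (auto simp: MPers_def compactification_def coarsely_perspective_def)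
  define e where "e = {(\<psi> s, g) | s g. s \<in> S \<and> g \<in> carrier G \<and> s \<in> \<phi> g ` K}"
  have SX: "S \<subseteq> topspace X" using S by (rule closedin_subset)
  have "e \<subseteq> {(\<psi> s, g) | s g. s \<in> topspace X \<and> g \<in> carrier G \<and> s \<in> \<phi> g ` K}"
    using SX unfolding e_def by blast
  then have e: "e \<in> group_coarse G"
    using coarse_inverse_fundamental_domain[OF X x0 K \<psi>] coarse_structure_group_coarse
    unfolding coarse_structure_def by blast
  then have e': "e\<inverse> \<in> group_coarse G"
    using coarse_structure_group_coarse unfolding coarse_structure_def by blast
  \<comment> \<open>The translates of \<open>K\<close> cover \<open>X\<close>, so every
    \<open>s\<close> in \<open>S\<close> is related to some \<open>g\<close>.\<close>
  have dom: "Domain e = \<psi> ` S"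
    using SX unfolding e_def cov[symmetric] by blast
  have ran: "Range e = {g \<in> carrier G. \<phi> g ` K \<inter> S \<noteq> {}}"
    unfolding e_def by blast
  have "\<psi> ` S \<subseteq> carrier G"
    using \<psi> SX by (auto simp: coarse_inverse_def coarse_map_def bornologous_def)
  then have cl: "closedin (group_top G) (Domain e)" "closedin (group_top G) (Range e)"
    by (auto simp: dom ran group_top_def)
  have "f (Domain e) \<subseteq> f (Range e)"
    using glue_coarse_boundary_subset[OF f T subsetD[OF pers e]] cl by blast
  moreover have "f (Range e) \<subseteq> f (Domain e)"
    using glue_coarse_boundary_subset[OF f T subsetD[OF pers e']] cl by simp
  ultimately show ?thesis unfolding dom ran by blast
qed

theorem theorem2p8:
  fixes G :: "('g, 'm) monoid_scheme" and X :: "'x topology"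
    and \<phi> :: "'g \<Rightarrow> 'x \<Rightarrow> 'x" and \<psi> :: "'x \<Rightarrow> 'g" and x0 :: 'x and K :: "'x set"
  assumes "group G" and "countable (carrier G)"
    and "Hausdorff_space X" and "locally_compact_space X" and "paracompact_space X"
    and "second_countable X"
    and "action_by_homeos G X \<phi>" and "properly_discontinuous G X \<phi>" and "cocompact G X \<phi>"
    and "x0 \<in> topspace X"
    and "coarse_inverse (carrier G) (group_coarse G) (topspace X) (action_coarse G X \<phi>)
           (\<lambda>g. \<phi> g x0) \<psi>"
    and "compactin X K" and "(\<Union>g\<in>carrier G. \<phi> g ` K) = topspace X"
  shows "restrict_functor
           (pullback_functor G X \<phi> \<psi> ::
              (('g, 'y) corona, 'g + 'y \<Rightarrow> 'g + 'y, ('x, 'y) corona, 'x + 'y \<Rightarrow> 'x + 'y) functor_data)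
           (EMPers0_group G)
         = extend_codomain (Pi_functor G X \<phi> K) (MPers X (action_coarse G X \<phi>))"
proof -
  interpret group G by fact
  let ?E = "EMPers0_group G :: (('g, 'y) corona, 'g + 'y \<Rightarrow> 'g + 'y) concrete_cat"
  let ?M = "MPers (group_top G) (group_coarse G) :: (('g, 'y) corona, 'g + 'y \<Rightarrow> 'g + 'y) concrete_cat"
  have sub: "A \<in> Obj ?M" if "A \<in> Obj ?E" for A
    using Obj_EMPers0_group_subset that by blast
  \<comment> \<open>Both functors keep the boundary \<open>Y\<close> and share
    \<open>transfer_morphism\<close>, so they can differ only in the boundary maps compared
    here.\<close>
  have "(\<lambda>S\<in>Collect (closedin X). f (\<psi> ` S)) =
      (\<lambda>S\<in>Collect (closedin X). f {g \<in> carrier G. \<phi> g ` K \<inter> S \<noteq> {}})"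
    if "(Y, f) \<in> Obj ?E" for Y f
    using assms by (intro restrict_ext pullback_boundary_eq[OF _ _ _ _ _ sub[OF that]]) auto
  then have "restrict (omap (pullback_functor G X \<phi> \<psi>)) (Obj ?E) = omap (Pi_functor G X \<phi> K)"
    using sub by (auto simp: pullback_functor_def Pi_functor_def make_functor_def intro!: restrict_ext)
  \<comment> \<open>Equivariant morphisms are morphisms of the larger category, so the nested
    restrictions of \<open>fmap\<close> give the actual values on them rather than
    \<open>undefined\<close>.\<close>
  moreover have "m \<in> Mor ?M A B" if "m \<in> Mor ?E A B" for A B m
    using that by (simp add: EMPers0_group_def EMPers0_def MPers_def)
  then have "(\<lambda>A\<in>Obj ?E. \<lambda>B\<in>Obj ?E. \<lambda>m\<in>Mor ?E A B. fmap (pullback_functor G X \<phi> \<psi>) A B m) =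
      fmap (Pi_functor G X \<phi> K)"
    using sub by (auto simp: pullback_functor_def Pi_functor_def make_functor_def intro!: restrict_ext)
  ultimately show ?thesis
    by (simp add: restrict_functor_def extend_codomain_def pullback_functor_def Pi_functor_def
        make_functor_def)
qed

end
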